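(* Let $G$ and $H$ be non-discrete unimodular locally compact second countable compactly generated groups. Assume there exist increasing functions $f_G$ and $f_H$ with $f_G\simeq V_G$, $f_H\simeq V_H$, and, as $t\to+\infty$: (1) $f_G^{-1}(t)=o(f_H^{-1}(t))$; (2) for every $C>0$, $f_G^{-1}(Ct)=O(f_G^{-1}(t))$; (3) for every $C>0$, $f_G^{-1}\circ f_H(Ct)=O(f_G^{-1}\circ f_H(t))$. Then there is no $(f_G^{-1}\circ f_H,\mathrm{L}^0)$-integrable measure equivalence coupling from $G$ to $H$.
   Context: Compactly generated: compact $S_G$ with $G=\bigcup_{n\ge0}S_G^n$, word length $|g|_G=\min\{n:g\in S_G^n\}$, Haar measure $\lambda_G$; volume growth $V_G(n)=\lambda_G(\{g:|g|_G\le n\})$. $\varphi\preccurlyeq\psi$ means $\varphi(t)\le C\psi(Ct)$ for some $C>0$ and large $t$; $\simeq$ means both. $f^{-1}$ denotes the inverse function. Measure equivalence coupling between unimodular lcsc $G,H$: measure space $(\Omega,\mu)$ with commuting measure-preserving $G$- and $H$-actions (written $\ast$), subsets $X_G,X_H$ with finite measures $\nu_G,\nu_H$ such that $(g,x)\mapsto g\ast x$ is a measure space isomorphism $(G\times X_G,\lambda_G\otimes\nu_G)\to(\Omega,\mu)$ and likewise for $H\times X_H$. Cocycle $\alpha\colon G\times X_H\to H$: $\alpha(g,x)\ast g\ast x$ is the unique point of $(H\ast g\ast x)\cap X_H$. For non-decreasing $\varphi$ with $\varphi(Ct)=O(\varphi(t))$ for all $C>0$, the coupling is $(\varphi,\mathrm{L}^0)$-integrable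 from $G$ to $H$ if $\sup_{g\in S_G}\int_{X_H}\varphi(|\alpha(g,x)|_H)\,d\nu_H(x)<\infty$. *)

theory Defs
  imports "HOL-Analysis.Analysis" "HOL-Library.Landau_Symbols"
begin

text \<open>Groups are written additively (type class group_add, which does NOT assume
commutativity); 0 is the identity.\<close>

definition lcsc_group :: "'a::{group_add,t2_space,second_countable_topology} itself \<Rightarrow> bool" where
  "lcsc_group T \<longleftrightarrow>
     continuous_on UNIV (\<lambda>p::'a \<times> 'a. fst p + snd p) \<and>
     continuous_on UNIV (uminus :: 'a \<Rightarrow> 'a) \<and>
     locally_compact_space (euclidean :: 'a topology)"

definition non_discrete :: "'a::topological_space itself \<Rightarrow> bool" where
  "non_discrete T \<longleftrightarrow> \<not> (\<forall>x::'a. open {x})"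

definition haar_measure :: "'a::{group_add,topological_space} measure \<Rightarrow> bool" where
  "haar_measure lam \<longleftrightarrow>
     sets lam = sets borel \<and>
     (\<forall>A\<in>sets borel. \<forall>g. emeasure lam ((\<lambda>x. g + x) ` A) = emeasure lam A) \<and>
     (\<forall>K. compact K \<longrightarrow> emeasure lam K < \<infinity>) \<and>
     (\<forall>U. open U \<and> U \<noteq> {} \<longrightarrow> emeasure lam U > 0)"

definition unimodular_haar :: "'a::{group_add,topological_space} measure \<Rightarrow> bool" where
  "unimodular_haar lam \<longleftrightarrow> haar_measure lam \<and>
     (\<forall>A\<in>sets borel. \<forall>g. emeasure lam ((\<lambda>x. x + g) ` A) = emeasure lam A)"

fun set_pow :: "'a::group_add set \<Rightarrow> nat \<Rightarrow> 'a set" where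
  "set_pow S 0 = {0}"
| "set_pow S (Suc n) = {a + b | a b. a \<in> set_pow S n \<and> b \<in> S}"

definition compact_generating :: "'a::{group_add,topological_space} set \<Rightarrow> bool" where
  "compact_generating S \<longleftrightarrow> compact S \<and> (\<Union>n. set_pow S n) = UNIV"

definition word_len :: "'a::group_add set \<Rightarrow> 'a \<Rightarrow> nat" where
  "word_len S g = (LEAST n. g \<in> set_pow S n)"

definition vol_growth :: "'a::group_add measure \<Rightarrow> 'a set \<Rightarrow> real \<Rightarrow> real" where
  "vol_growth lam S t = measure lam {g. real (word_len S g) \<le> t}"

definition asym_le :: "(real \<Rightarrow> real) \<Rightarrow> (real \<Rightarrow> real) \<Rightarrow> bool" where
  "asym_le phi psi \<longleftrightarrow> (\<exists>C>0. \<forall>\<^sub>F t in at_top. phi t \<le> C * psi (C * t))"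

definition asym_eq :: "(real \<Rightarrow> real) \<Rightarrow> (real \<Rightarrow> real) \<Rightarrow> bool" where
  "asym_eq phi psi \<longleftrightarrow> asym_le phi psi \<and> asym_le psi phi"

definition meas_iso :: "'a measure \<Rightarrow> 'b measure \<Rightarrow> ('a \<Rightarrow> 'b) \<Rightarrow> bool" where
  "meas_iso M N F \<longleftrightarrow> bij_betw F (space M) (space N) \<and> F \<in> measurable M N \<and>
     the_inv_into (space M) F \<in> measurable N M \<and> distr M N F = N"

definition mp_action :: "'g::group_add measure \<Rightarrow> 'w measure \<Rightarrow> ('g \<Rightarrow> 'w \<Rightarrow> 'w) \<Rightarrow> bool" where
  "mp_action lam Om a \<longleftrightarrow>
     (\<forall>w\<in>space Om. a 0 w = w) \<and>
     (\<forall>g g'. \<forall>w\<in>space Om. a (g + g') w = a g (a g' w)) \<and>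
     (\<lambda>p. a (fst p) (snd p)) \<in> measurable (lam \<Otimes>\<^sub>M Om) Om \<and>
     (\<forall>g. a g \<in> measurable Om Om \<and> distr Om Om (a g) = Om)"

text \<open>Measure equivalence coupling between G and H; X_G = space nuG, X_H = space nuH.\<close>
definition me_coupling ::
  "'g::group_add measure \<Rightarrow> 'h::group_add measure \<Rightarrow> 'w measure \<Rightarrow>
   ('g \<Rightarrow> 'w \<Rightarrow> 'w) \<Rightarrow> ('h \<Rightarrow> 'w \<Rightarrow> 'w) \<Rightarrow> 'w measure \<Rightarrow> 'w measure \<Rightarrow> bool" where
  "me_coupling lamG lamH Om aG aH nuG nuH \<longleftrightarrow>
     mp_action lamG Om aG \<and> mp_action lamH Om aH \<and>
     (\<forall>g h. \<forall>w\<in>space Om. aG g (aH h w) = aH h (aG g w)) \<and>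
     space nuG \<subseteq> space Om \<and> space nuH \<subseteq> space Om \<and>
     0 < emeasure nuG (space nuG) \<and> emeasure nuG (space nuG) < \<infinity> \<and>
     0 < emeasure nuH (space nuH) \<and> emeasure nuH (space nuH) < \<infinity> \<and>
     meas_iso (lamG \<Otimes>\<^sub>M nuG) Om (\<lambda>p. aG (fst p) (snd p)) \<and>
     meas_iso (lamH \<Otimes>\<^sub>M nuH) Om (\<lambda>p. aH (fst p) (snd p))"

definition cocycle :: "('g \<Rightarrow> 'w \<Rightarrow> 'w) \<Rightarrow> ('h \<Rightarrow> 'w \<Rightarrow> 'w) \<Rightarrow> 'w measure \<Rightarrow> 'g \<Rightarrow> 'w \<Rightarrow> 'h" where
  "cocycle aG aH nuH g x = (THE h. aH h (aG g x) \<in> space nuH)"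

definition phi_L0_integrable ::
  "(real \<Rightarrow> real) \<Rightarrow> 'g set \<Rightarrow> 'h::group_add set \<Rightarrow>
   ('g \<Rightarrow> 'w \<Rightarrow> 'w) \<Rightarrow> ('h \<Rightarrow> 'w \<Rightarrow> 'w) \<Rightarrow> 'w measure \<Rightarrow> bool" where
  "phi_L0_integrable phi SG SH aG aH nuH \<longleftrightarrow>
     (SUP g\<in>SG. \<integral>\<^sup>+ x. ennreal (phi (real (word_len SH (cocycle aG aH nuH g x)))) \<partial>nuH) < \<infinity>"

end

theory Submission
  imports Defs
begin

text \<open>
  Put \<open>\<phi> = f\<^sub>G\<^sup>-\<^sup>1 \<circ> f\<^sub>H\<close> and \<open>X\<^sub>g(x) = |\<alpha>(g,x)|\<^sub>H\<close>. If \<open>X\<^sub>g < R\<close> holds with large probability for all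
  \<open>g\<close> in the ball of radius \<open>n\<close>, a double counting in the coupling space gives
  \<open>V\<^sub>G(n) \<le> C V\<^sub>H(R + m)\<close> with \<open>C\<close>, \<open>m\<close> independent of \<open>n\<close>, \<open>R\<close>. It then suffices to reach
  \<open>n = N \<phi>(R)\<close> for every \<open>N\<close> and arbitrarily large \<open>R\<close>, because (2) and (3) make
  \<open>V\<^sub>G(N \<phi>(R))\<close> larger than any multiple of \<open>V\<^sub>H(2 R)\<close>.

  By the cocycle identity the truncated mean \<open>\<integral> min(X\<^sub>g, R)\<close> is subadditive in \<open>g\<close>, so by Markov
  one needs \<open>(\<phi>(R)/R) \<integral> min(X\<^sub>s, R) \<rightarrow> 0\<close> uniformly in \<open>s \<in> S\<^sub>G\<close>. Hypothesis (1) says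
  \<open>\<phi>(t) = o(t)\<close>, so there are arbitrarily large \<open>R\<close> at which \<open>\<phi>(k)/k\<close> attains a record minimum;
  along these the integrand is dominated by \<open>\<phi>(X\<^sub>s)\<close> up to a constant and converges to 0. Pointwise
  convergence becomes uniform on \<open>S\<^sub>G\<close> by subadditivity and an Egorov--Steinhaus argument.
\<close>

section \<open>Word length, balls and Haar measure on a compactly generated group\<close>

lemma set_pow_add:
  assumes "a \<in> set_pow S m" "b \<in> set_pow S n"
  shows "a + b \<in> set_pow S (m + n)"
  using assms
proof (induction n arbitrary: b)
  case 0
  then show ?case by simp
next
  case (Suc n)
  then obtain c s where "b = c + s" "c \<in> set_pow S n" "s \<in> S" by auto
  with Suc.IH[of c] Suc.prems show ?case
    by (auto simp: add.assoc[symmetric])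
qed

locale haar_group =
  fixes lam :: "'a::{group_add,t2_space,second_countable_topology} measure" and S :: "'a set"
  assumes group: "lcsc_group TYPE('a)"
    and haar: "unimodular_haar lam"
    and gen: "compact_generating S"
begin

abbreviation len :: "'a \<Rightarrow> nat" where "len \<equiv> word_len S"

definition wball :: "nat \<Rightarrow> 'a set" where "wball n = {g. len g \<le> n}"

lemma in_set_pow_len: "g \<in> set_pow S (len g)"
proof -
  have "\<exists>n. g \<in> set_pow S n"
    using gen unfolding compact_generating_def by (metis UNIV_I UN_E)
  then show ?thesis
    unfolding word_len_def by (rule LeastI_ex)
qed

lemma len_le: "g \<in> set_pow S n \<Longrightarrow> len g \<le> n"
  unfolding word_len_def by (rule Least_le)

lemma len_add: "len (g + h) \<le> len g + len h"
  by (intro len_le set_pow_add in_set_pow_len)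

lemma len_zero [simp]: "len 0 = 0"
  using len_le[of 0 0] by simp

text \<open>A compact generating set may fail to contain \<open>0\<close>, so its powers may fail to
  be nested and a ball is a union of powers rather than a single one.\<close>

lemma wball_eq: "wball n = (\<Union>k\<le>n. set_pow S k)"
  unfolding wball_def using in_set_pow_len len_le order_trans by blast

lemma sets_lam [measurable_cong, simp]: "sets lam = sets borel"
  using haar unfolding unimodular_haar_def haar_measure_def by simp

lemma space_lam [simp]: "space lam = UNIV"
  using sets_eq_imp_space_eq[OF sets_lam] by simp

lemma continuous_plus: "continuous_on UNIV (\<lambda>p::'a \<times> 'a. fst p + snd p)"
  using group unfolding lcsc_group_def by blast

lemma measurable_add:
  assumes [measurable]: "f \<in> borel_measurable M" "g \<in> borel_measurable M"
  shows "(\<lambda>x. f x + g x :: 'a) \<in> borel_measurable M"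
  using borel_measurable_continuous_Pair[OF assms, of "\<lambda>a b. a + b"] continuous_plus by simp

lemma measurable_uminus:
  assumes "f \<in> borel_measurable M"
  shows "(\<lambda>x. - f x :: 'a) \<in> borel_measurable M"
proof -
  have "continuous_on UNIV (uminus :: 'a \<Rightarrow> 'a)"
    using group unfolding lcsc_group_def by blast
  then show ?thesis
    using borel_measurable_continuous_onI measurable_compose[OF assms] by blast
qed

lemma compact_sum:
  assumes "compact A" "compact B"
  shows "compact {a + b | a b. a \<in> A \<and> b \<in> (B::'a set)}"
proof -
  have "{a + b | a b. a \<in> A \<and> b \<in> B} = (\<lambda>p. fst p + snd p) ` (A \<times> B)"
    by force
  moreover have "compact \<dots>"
    by (intro compact_continuous_image compact_Times assms
        continuous_on_subset[OF continuous_plus]) simp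
  ultimately show ?thesis by simp
qed

lemma compact_S: "compact S"
  using gen unfolding compact_generating_def by blast

lemma compact_wball: "compact (wball n)"
proof -
  have "compact (set_pow S k)" for k
    by (induction k) (simp_all add: compact_sum compact_S)
  then show ?thesis
    unfolding wball_eq by (intro compact_UN) auto
qed

lemma compact_measurable [measurable]: "compact A \<Longrightarrow> A \<in> sets (borel :: 'a measure)"
  by (intro borel_closed compact_imp_closed)

lemma wball_measurable [measurable]: "wball n \<in> sets borel"
  by (intro compact_measurable compact_wball)

lemma emeasure_compact: "compact A \<Longrightarrow> emeasure lam A < \<infinity>"
  using haar unfolding unimodular_haar_def haar_measure_def by blast

lemma emeasure_wball: "emeasure lam (wball n) < \<infinity>"
  by (intro emeasure_compact compact_wball)

lemma emeasure_wball_eq: "emeasure lam (wball n) = ennreal (measure lam (wball n))"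
  using emeasure_wball[of n] by (intro emeasure_eq_ennreal_measure) auto

lemma wball_mono: "m \<le> n \<Longrightarrow> wball m \<subseteq> wball n"
  unfolding wball_def by auto

lemma incseq_wball: "incseq wball"
  by (intro incseq_SucI wball_mono) simp

lemma UN_wball: "(\<Union>n. wball n) = UNIV"
  unfolding wball_def by auto

lemma sigma_finite: "sigma_finite_measure lam"
proof
  show "\<exists>A. countable A \<and> A \<subseteq> sets lam \<and> \<Union>A = space lam \<and> (\<forall>a\<in>A. emeasure lam a \<noteq> \<infinity>)"
    using emeasure_wball UN_wball
    by (intro exI[of _ "range wball"]) (auto simp: less_top)
qed

text \<open>Countably many balls cover the group, and the whole group, being open and nonempty, has
  positive measure. Such a ball also has finite measure, so its measure can later be
  cancelled.\<close>

lemma wball_positive: "\<exists>n. emeasure lam (wball n) > 0"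
proof (rule ccontr)
  assume "\<not> ?thesis"
  then have "emeasure lam (\<Union>n. wball n) = 0"
    by (intro emeasure_UN_eq_0) (auto simp: image_subset_iff)
  moreover have "emeasure lam UNIV > 0"
    using haar unfolding unimodular_haar_def haar_measure_def by auto
  ultimately show False
    unfolding UN_wball by simp
qed

lemma len_measurable [measurable]: "len \<in> measurable borel (count_space UNIV)"
proof (rule measurableI)
  fix A :: "nat set"
  have "len -` {k} \<in> sets borel" for k
  proof -
    have "len -` {k} = wball k - (\<Union>j<k. wball j)"
      unfolding wball_def by (auto simp: not_le) (metis lessThan_iff less_irrefl order_le_less)
    also have "\<dots> \<in> sets borel" by measurable
    finally show ?thesis .
  qed
  then have "(\<Union>k\<in>A. len -` {k}) \<in> sets borel"
    by auto
  also have "(\<Union>k\<in>A. len -` {k}) = len -` A \<inter> space borel" by auto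
  finally show "len -` A \<inter> space borel \<in> sets borel" .
qed simp

lemma emeasure_translate_left:
  assumes "A \<in> sets borel"
  shows "emeasure lam ((\<lambda>x. g + x) ` A) = emeasure lam A"
  using haar assms unfolding unimodular_haar_def haar_measure_def by blast

text \<open>This is where unimodularity enters: Haar measure is left invariant by definition, but
  the changes of variables in the coupling space are right translations.\<close>

lemma distr_translate_right: "distr lam lam (\<lambda>x. x + g) = lam"
proof (rule measure_eqI)
  fix A assume "A \<in> sets (distr lam lam (\<lambda>x. x + g))"
  then have A: "A \<in> sets borel" by simp
  have [measurable]: "(\<lambda>x. x + g) \<in> borel_measurable borel"
    by (intro measurable_add) auto
  have "(\<lambda>x. x + g) -` A = (\<lambda>x. x + (- g)) ` A"
    by (force simp: image_iff add.assoc)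
  moreover have "emeasure lam ((\<lambda>x. x + (- g)) ` A) = emeasure lam A"
    using A haar unfolding unimodular_haar_def by blast
  ultimately show "emeasure (distr lam lam (\<lambda>x. x + g)) A = emeasure lam A"
    using A by (subst emeasure_distr) auto
qed simp

lemma nn_integral_translate_right:
  assumes [measurable]: "f \<in> borel_measurable borel"
  shows "(\<integral>\<^sup>+x. f (x + g) \<partial>lam) = (\<integral>\<^sup>+x. f x \<partial>lam)"
proof -
  have [measurable]: "(\<lambda>x. x + g) \<in> borel_measurable borel"
    by (intro measurable_add) auto
  have "(\<integral>\<^sup>+x. f x \<partial>lam) = (\<integral>\<^sup>+x. f x \<partial>distr lam lam (\<lambda>x. x + g))"
    by (simp add: distr_translate_right)
  also have "\<dots> = (\<integral>\<^sup>+x. f (x + g) \<partial>lam)"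
    by (intro nn_integral_distr) auto
  finally show ?thesis by simp
qed

section \<open>Subadditive functions on the group\<close>

lemma set_pow_subadditive_bound:
  assumes "u 0 = (0::ennreal)" "\<And>g h. u (g + h) \<le> u g + u h"
    and "\<And>s. s \<in> S \<Longrightarrow> u s \<le> c" and "g \<in> set_pow S k"
  shows "u g \<le> of_nat k * c"
  using assms(4)
proof (induction k arbitrary: g)
  case 0
  then show ?case using assms(1) by simp
next
  case (Suc k)
  then obtain a s where g: "g = a + s" and a: "a \<in> set_pow S k" and s: "s \<in> S" by auto
  have "u g \<le> u a + u s" unfolding g by (rule assms(2))
  also have "\<dots> \<le> of_nat k * c + c"
    by (intro add_mono Suc.IH a assms(3) s)
  finally show ?case by (simp add: distrib_right add.commute)
qed

text \<open>A Steinhaus-type argument: by Egorov the \<open>u i\<close> are uniformly small on a symmetric set that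
is almost all of a compact set, so each element of \<open>S\<close> is a sum of two elements of it.\<close>

lemma subadditive_tendsto_uniform:
  fixes u :: "nat \<Rightarrow> 'a \<Rightarrow> ennreal"
  assumes meas [measurable]: "\<And>j. u j \<in> borel_measurable borel"
    and subadd: "\<And>j g h. u j (g + h) \<le> u j g + u j h"
    and lim: "\<And>g. (\<lambda>j. u j g) \<longlonglongrightarrow> 0"
    and "\<epsilon> > 0"
  shows "\<exists>j. \<forall>i\<ge>j. \<forall>s\<in>S. u i s \<le> 2 * \<epsilon>"
proof -
  obtain n where n: "emeasure lam (wball n) > 0"
    using wball_positive by blast
  define Q where "Q = wball n"
  have Q [measurable]: "Q \<in> sets borel" and Qfin: "emeasure lam Q < \<infinity>"
    unfolding Q_def using emeasure_wball by auto
  \<comment> \<open>\<open>P\<close> contains \<open>q\<close> and \<open>s + q\<close> for all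
    \<open>q\<close> in \<open>Q\<close> and \<open>s\<close> in \<open>S\<close> at once, so one
    index \<open>j\<close> serves every \<open>s\<close>.\<close>
  define P where "P = Q \<union> {a + b | a b. a \<in> S \<and> b \<in> Q}"
  have "compact P"
    unfolding P_def Q_def by (intro compact_Un compact_sum compact_wball compact_S)
  then have P [measurable]: "P \<in> sets borel" and Pfin: "emeasure lam P < \<infinity>"
    using emeasure_compact[of P] by auto
  define F where "F j = {g. \<forall>i\<ge>j. u i g \<le> \<epsilon> \<and> u i (- g) \<le> \<epsilon>}" for j
  have [measurable]: "(\<lambda>g. u i (- g)) \<in> borel_measurable borel" for i
    by (rule measurable_compose[OF measurable_uminus meas]) auto
  have F [measurable]: "F j \<in> sets borel" for j
    unfolding F_def by measurable
  have "(\<Inter>j. P - F j) = {}"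
  proof -
    have "\<exists>j. g \<in> F j" for g
    proof -
      have "\<forall>\<^sub>F j in sequentially. u j g < \<epsilon> \<and> u j (- g) < \<epsilon>"
        using lim \<open>\<epsilon> > 0\<close> by (intro eventually_conj order_tendstoD(2)) auto
      then show ?thesis
        unfolding F_def eventually_sequentially by (auto intro: less_imp_le)
    qed
    then show ?thesis by blast
  qed
  moreover have "(\<lambda>j. emeasure lam (P - F j)) \<longlonglongrightarrow> emeasure lam (\<Inter>j. P - F j)"
  proof (rule Lim_emeasure_decseq)
    show "decseq (\<lambda>j. P - F j)"
      unfolding F_def by (intro decseq_SucI) auto
    show "emeasure lam (P - F j) \<noteq> \<infinity>" for j
      using Pfin emeasure_mono[of "P - F j" P lam] by (auto simp: less_top[symmetric] top_unique)
  qed auto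
  ultimately have "(\<lambda>j. emeasure lam (P - F j)) \<longlonglongrightarrow> 0"
    by (simp only: emeasure_empty)
  then have "\<forall>\<^sub>F j in sequentially. emeasure lam (P - F j) < emeasure lam Q / 2"
    using n Qfin by (intro order_tendstoD(2)) (auto simp: Q_def ennreal_zero_less_divide)
  then obtain j where j: "emeasure lam (P - F j) < emeasure lam Q / 2"
    unfolding eventually_sequentially by auto
  have "u i s \<le> 2 * \<epsilon>" if "i \<ge> j" "s \<in> S" for i s
  proof -
    let ?sh = "\<lambda>x. s + x"
    have sh: "?sh ` A \<in> sets borel" if [measurable]: "A \<in> sets borel" for A
    proof -
      have "?sh ` A = (\<lambda>x. - s + x) -` A \<inter> space borel"
        by (force simp: image_iff add.assoc[symmetric])
      moreover have "(\<lambda>x. - s + x) \<in> borel_measurable borel"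
        by (intro measurable_add) auto
      ultimately show ?thesis
        using that by (metis measurable_sets)
    qed
    \<comment> \<open>If the inclusion held, each \<open>s + q\<close> would be bad itself or come
      from a bad \<open>q\<close>. By left invariance both bad sets have less than half the measure
      of \<open>Q\<close>, so some \<open>q\<close> is good in both respects, and then
      \<open>s = (s + q) + (- q)\<close>.\<close>
    have "\<not> ?sh ` Q \<subseteq> (P - F j) \<union> ?sh ` (P - F j)"
    proof
      assume "?sh ` Q \<subseteq> (P - F j) \<union> ?sh ` (P - F j)"
      then have "emeasure lam (?sh ` Q) \<le> emeasure lam (P - F j) + emeasure lam (?sh ` (P - F j))"
        by (intro order_trans[OF emeasure_mono emeasure_subadditive]) (auto intro!: sh)
      then have "emeasure lam Q \<le> emeasure lam (P - F j) + emeasure lam (P - F j)"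
        by (simp add: emeasure_translate_left)
      also have "\<dots> < emeasure lam Q / 2 + emeasure lam Q / 2"
        using j by (intro add_strict_mono)
      finally show False
        by (simp add: ennreal_divide_times[symmetric] flip: mult_2)
    qed
    then obtain q where q: "q \<in> Q" "s + q \<notin> P - F j" "s + q \<notin> ?sh ` (P - F j)"
      by auto
    moreover have "s + q \<in> P" "q \<in> P"
      using q(1) \<open>s \<in> S\<close> unfolding P_def by auto
    ultimately have "s + q \<in> F j" "q \<in> F j"
      by auto
    then have "u i (s + q) \<le> \<epsilon>" "u i (- q) \<le> \<epsilon>"
      using \<open>i \<ge> j\<close> unfolding F_def by auto
    moreover have "u i s \<le> u i (s + q) + u i (- q)"
      using subadd[of i "s + q" "- q"] by (simp add: add.assoc)
    ultimately show ?thesis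
      by (metis add_mono mult_2 order_trans)
  qed
  then show ?thesis by blast
qed

end

section \<open>Coordinates with respect to a fundamental domain\<close>

locale fund_domain = haar_group lam S
  for lam :: "'a::{group_add,t2_space,second_countable_topology} measure" and S :: "'a set" +
  fixes Om :: "'w measure" and a :: "'a \<Rightarrow> 'w \<Rightarrow> 'w" and nu :: "'w measure"
  assumes action: "mp_action lam Om a"
    and dom_subset: "space nu \<subseteq> space Om"
    and dom_pos: "0 < emeasure nu (space nu)"
    and dom_finite: "emeasure nu (space nu) < \<infinity>"
    and iso: "meas_iso (lam \<Otimes>\<^sub>M nu) Om (\<lambda>p. a (fst p) (snd p))"
begin

definition coords :: "'w \<Rightarrow> 'a \<times> 'w" where
  "coords = the_inv_into (space (lam \<Otimes>\<^sub>M nu)) (\<lambda>p. a (fst p) (snd p))"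

text \<open>Convention: \<open>grp w\<close> carries the representative \<open>pt w\<close> out to
  \<open>w\<close>. The element that brings \<open>w\<close> back into the domain is its
  inverse.\<close>

definition grp :: "'w \<Rightarrow> 'a" where "grp w = fst (coords w)"

definition pt :: "'w \<Rightarrow> 'w" where "pt w = snd (coords w)"

lemma bij_coords: "bij_betw (\<lambda>p. a (fst p) (snd p)) (UNIV \<times> space nu) (space Om)"
  using iso unfolding meas_iso_def by (simp add: space_pair_measure)

lemma coords_measurable [measurable]: "coords \<in> measurable Om (lam \<Otimes>\<^sub>M nu)"
  using iso unfolding meas_iso_def coords_def by blast

lemma grp_measurable [measurable]: "grp \<in> borel_measurable Om"
proof -
  have "grp \<in> measurable Om lam"
    unfolding grp_def by measurable
  then show ?thesis by (simp cong: measurable_cong_sets)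
qed

lemma pt_measurable [measurable]: "pt \<in> measurable Om nu"
  unfolding pt_def by measurable

lemma pt_in: "w \<in> space Om \<Longrightarrow> pt w \<in> space nu"
  using measurable_space[OF pt_measurable] .

lemma decomp: "w \<in> space Om \<Longrightarrow> a (grp w) (pt w) = w"
  using f_the_inv_into_f_bij_betw[OF bij_coords, of w]
  unfolding grp_def pt_def coords_def by (simp add: space_pair_measure)

lemma coords_act: "x \<in> space nu \<Longrightarrow> coords (a h x) = (h, x)"
  using the_inv_into_f_f[of "\<lambda>p. a (fst p) (snd p)" "UNIV \<times> space nu" "(h, x)"] bij_coords
  unfolding coords_def bij_betw_def by (simp add: space_pair_measure)

lemma grp_act_dom [simp]: "x \<in> space nu \<Longrightarrow> grp (a h x) = h"
  by (simp add: grp_def coords_act)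

lemma pt_act_dom [simp]: "x \<in> space nu \<Longrightarrow> pt (a h x) = x"
  by (simp add: pt_def coords_act)

lemma act_zero [simp]: "w \<in> space Om \<Longrightarrow> a 0 w = w"
  using action unfolding mp_action_def by blast

lemma act_add: "w \<in> space Om \<Longrightarrow> a (g + h) w = a g (a h w)"
  using action unfolding mp_action_def by blast

lemma act_measurable1: "a g \<in> measurable Om Om"
  using action unfolding mp_action_def by blast

lemma act_in [simp]: "w \<in> space Om \<Longrightarrow> a g w \<in> space Om"
  using measurable_space[OF act_measurable1] .

lemma grp_act: "w \<in> space Om \<Longrightarrow> grp (a g w) = g + grp w"
proof -
  assume w: "w \<in> space Om"
  then have "pt w \<in> space nu" "pt w \<in> space Om"
    using dom_subset by (auto simp: pt_in)
  then show ?thesis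
    using act_add[of "pt w" g "grp w"] grp_act_dom[of "pt w" "g + grp w"] w
    by (simp add: decomp)
qed

lemma act_measurable [measurable (raw)]:
  assumes [measurable]: "f \<in> borel_measurable M" "w \<in> measurable M Om"
  shows "(\<lambda>x. a (f x) (w x)) \<in> measurable M Om"
proof -
  have [measurable]: "f \<in> measurable M lam"
    using assms(1) by (simp cong: measurable_cong_sets)
  have "(\<lambda>p. a (fst p) (snd p)) \<in> measurable (lam \<Otimes>\<^sub>M Om) Om"
    using action unfolding mp_action_def by blast
  then have "(\<lambda>p. a (fst p) (snd p)) \<circ> (\<lambda>x. (f x, w x)) \<in> measurable M Om"
    by (intro measurable_comp) auto
  then show ?thesis by (simp add: comp_def)
qed

text \<open>The sigma-algebra of \<open>nu\<close> is not given as a restriction of that of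
  \<open>Om\<close>, so measurability is read off from the parametrisation of \<open>Om\<close> on
  the slice over the identity, where it is \<open>x = a 0 x\<close>.\<close>

lemma dom_inclusion_measurable: "(\<lambda>x. x) \<in> measurable nu Om"
proof -
  have "(\<lambda>p. a (fst p) (snd p)) \<in> measurable (lam \<Otimes>\<^sub>M nu) Om"
    using iso unfolding meas_iso_def by blast
  then have "(\<lambda>p. a (fst p) (snd p)) \<circ> (\<lambda>x. (0, x)) \<in> measurable nu Om"
    by (intro measurable_comp) auto
  then show ?thesis
    using dom_subset by (subst measurable_cong[where g = "\<lambda>x. a 0 x"]) (auto simp: comp_def)
qed

lemma nn_integral_Om:
  assumes [measurable]: "F \<in> borel_measurable Om"
  shows "(\<integral>\<^sup>+w. F w \<partial>Om) = (\<integral>\<^sup>+x. \<integral>\<^sup>+h. F (a h x) \<partial>lam \<partial>nu)"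
proof -
  interpret nu: finite_measure nu
    using dom_finite by (intro finite_measureI) auto
  interpret lam: sigma_finite_measure lam by (rule sigma_finite)
  interpret pair_sigma_finite lam nu ..
  have [measurable]: "(\<lambda>p. a (fst p) (snd p)) \<in> measurable (lam \<Otimes>\<^sub>M nu) Om"
    and d: "distr (lam \<Otimes>\<^sub>M nu) Om (\<lambda>p. a (fst p) (snd p)) = Om"
    using iso unfolding meas_iso_def by blast+
  have "(\<integral>\<^sup>+w. F w \<partial>Om) = (\<integral>\<^sup>+w. F w \<partial>distr (lam \<Otimes>\<^sub>M nu) Om (\<lambda>p. a (fst p) (snd p)))"
    by (simp add: d)
  also have "\<dots> = (\<integral>\<^sup>+p. F (a (fst p) (snd p)) \<partial>(lam \<Otimes>\<^sub>M nu))"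
    by (intro nn_integral_distr) auto
  also have "\<dots> = (\<integral>\<^sup>+x. \<integral>\<^sup>+h. F (a h x) \<partial>lam \<partial>nu)"
    by (subst nn_integral_snd[symmetric]) auto
  finally show ?thesis .
qed

lemma nn_integral_Om_act:
  assumes [measurable]: "F \<in> borel_measurable Om"
  shows "(\<integral>\<^sup>+w. F (a g w) \<partial>Om) = (\<integral>\<^sup>+w. F w \<partial>Om)"
proof -
  note act_measurable1[measurable]
  have "(\<integral>\<^sup>+w. F (a g w) \<partial>Om) = (\<integral>\<^sup>+w. F w \<partial>distr Om Om (a g))"
    by (intro nn_integral_distr[symmetric]) auto
  also have "distr Om Om (a g) = Om"
    using action unfolding mp_action_def by blast
  finally show ?thesis .
qed

lemma emeasure_slab:
  assumes [measurable]: "A \<in> sets borel"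
  shows "emeasure Om {w \<in> space Om. grp w \<in> A} = emeasure lam A * emeasure nu (space nu)"
proof -
  have [measurable]: "{w \<in> space Om. grp w \<in> A} \<in> sets Om" by measurable
  have "emeasure Om {w \<in> space Om. grp w \<in> A} = (\<integral>\<^sup>+w. indicator {w \<in> space Om. grp w \<in> A} w \<partial>Om)"
    by simp
  also have "\<dots> = (\<integral>\<^sup>+x. \<integral>\<^sup>+h. indicator {w \<in> space Om. grp w \<in> A} (a h x) \<partial>lam \<partial>nu)"
    by (rule nn_integral_Om) measurable
  also have "\<dots> = (\<integral>\<^sup>+x. \<integral>\<^sup>+h. indicator A h \<partial>lam \<partial>nu)"
    using dom_subset by (intro nn_integral_cong) (auto simp: indicator_def subset_iff)
  also have "\<dots> = emeasure lam A * emeasure nu (space nu)"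
    by simp
  finally show ?thesis .
qed

lemma sigma_finite_Om: "sigma_finite_measure Om"
proof
  let ?A = "\<lambda>n. {w \<in> space Om. grp w \<in> wball n}"
  have "emeasure Om (?A n) \<noteq> \<infinity>" for n
    using emeasure_wball[of n] dom_finite by (auto simp: emeasure_slab ennreal_mult_eq_top_iff)
  moreover have "(\<Union>n. ?A n) = space Om"
    using UN_wball by blast
  ultimately show "\<exists>A. countable A \<and> A \<subseteq> sets Om \<and> \<Union>A = space Om \<and> (\<forall>a\<in>A. emeasure Om a \<noteq> \<infinity>)"
    by (intro exI[of _ "range ?A"]) auto
qed

end

section \<open>The cocycle and the induced action on the fundamental domain of
  \<open>H\<close>\<close>

locale coupling = G: fund_domain lamG SG Om aG nuG + H: fund_domain lamH SH Om aH nuH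
  for lamG :: "'g::{group_add,t2_space,second_countable_topology} measure" and SG
    and lamH :: "'h::{group_add,t2_space,second_countable_topology} measure" and SH
    and Om :: "'w measure" and aG aH nuG nuH +
  assumes commute: "w \<in> space Om \<Longrightarrow> aG g (aH h w) = aH h (aG g w)"
begin

definition coc :: "'g \<Rightarrow> 'w \<Rightarrow> 'h" where "coc g x = - H.grp (aG g x)"

text \<open>The action of \<open>G\<close> on the space of \<open>H\<close>-orbits of
  \<open>Om\<close>, transported to the domain, which contains one point of each orbit.\<close>

definition act :: "'g \<Rightarrow> 'w \<Rightarrow> 'w" where "act g x = H.pt (aG g x)"

abbreviation coc_len :: "'g \<Rightarrow> 'w \<Rightarrow> nat" where "coc_len g x \<equiv> H.len (coc g x)"

lemma dom_Om: "x \<in> space nuH \<Longrightarrow> x \<in> space Om"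
  using H.dom_subset by blast

lemma act_in: "x \<in> space nuH \<Longrightarrow> act g x \<in> space nuH"
  unfolding act_def by (simp add: H.pt_in dom_Om)

text \<open>\<open>H.grp\<close> is equivariant and vanishes on the domain, so an element returning
  \<open>aG g x\<close> to the domain must be the inverse of its
  \<open>H\<close>-coordinate.\<close>

lemma cocycle_eq:
  assumes x: "x \<in> space nuH"
  shows "cocycle aG aH nuH g x = coc g x"
proof -
  have w: "aG g x \<in> space Om" using x by (simp add: dom_Om)
  have grp: "H.grp (aH h (aG g x)) = h + H.grp (aG g x)" for h
    using w by (rule H.grp_act)
  show ?thesis
    unfolding cocycle_def
  proof (rule the_equality)
    show "aH (coc g x) (aG g x) \<in> space nuH"
    proof -
      have "aH (coc g x) (aG g x) = aH (coc g x + H.grp (aG g x)) (act g x)"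
        using w H.act_add[OF dom_Om[OF act_in[OF x]]] by (simp only: act_def H.decomp)
      then show ?thesis
        using act_in[OF x] by (simp add: coc_def dom_Om)
    qed
  next
    fix h assume h: "aH h (aG g x) \<in> space nuH"
    \<comment> \<open>The trivial factor \<open>aH 0\<close> brings the point into the form
      \<open>aH h x\<close> with \<open>x\<close> in the domain, whose coordinate is known.\<close>
    then have "H.grp (aH 0 (aH h (aG g x))) = 0"
      by (rule H.grp_act_dom)
    then have "h + H.grp (aG g x) = 0"
      using w by (simp add: grp)
    then show "h = coc g x"
      unfolding coc_def by (rule eq_neg_iff_add_eq_0[THEN iffD2])
  qed
qed

lemma act_eq: "x \<in> space nuH \<Longrightarrow> aG g x = aH (- coc g x) (act g x)"
  unfolding coc_def act_def by (simp add: H.decomp dom_Om)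

text \<open>Since the actions commute, \<open>g\<close> acts in the coordinates
  \<open>(h, x)\<close> by moving the base point with \<open>act g\<close> and translating the
  \<open>H\<close>-coordinate on the right by the inverse of the cocycle.\<close>

lemma aG_aH: "x \<in> space nuH \<Longrightarrow> aG g (aH h x) = aH (h - coc g x) (act g x)"
  using H.act_add[of "act g x" h "- coc g x"] commute[of x g h] act_eq[of x g]
  by (simp add: dom_Om act_in)

text \<open>Acting first by \<open>g'\<close> and then by \<open>g\<close> gives the
  \<open>H\<close>-coordinate of \<open>aG (g + g') x\<close> a second time; negating it yields the
  cocycle identity.\<close>

lemma coc_add: "x \<in> space nuH \<Longrightarrow> coc (g + g') x = coc g (act g' x) + coc g' x"
proof -
  assume x: "x \<in> space nuH"
  have "aG (g + g') x = aG g (aH (- coc g' x) (act g' x))"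
    using x by (simp add: G.act_add dom_Om flip: act_eq)
  also have "\<dots> = aH (- coc g' x - coc g (act g' x)) (act g (act g' x))"
    by (rule aG_aH) (rule act_in[OF x])
  finally show ?thesis
    using x unfolding coc_def[of "g + g'"] by (simp add: act_in)
qed

lemma coc_zero: "x \<in> space nuH \<Longrightarrow> coc 0 x = 0"
  using H.grp_act_dom[of x 0] by (simp add: coc_def dom_Om)

lemma coc_len_add: "x \<in> space nuH \<Longrightarrow> coc_len (g + g') x \<le> coc_len g (act g' x) + coc_len g' x"
  by (simp add: coc_add H.len_add)

lemma measurable_aG_dom [measurable]: "(\<lambda>p. aG (fst p) (snd p)) \<in> measurable (borel \<Otimes>\<^sub>M nuH) Om"
proof (rule G.act_measurable)
  show "snd \<in> measurable (borel \<Otimes>\<^sub>M nuH) Om"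
    using measurable_compose[OF measurable_snd H.dom_inclusion_measurable] .
qed measurable

lemma measurable_coc_len:
  "(\<lambda>p. coc_len (fst p) (snd p)) \<in> measurable (borel \<Otimes>\<^sub>M nuH) (count_space UNIV)"
  unfolding coc_def
  by (rule measurable_compose[OF H.measurable_uminus H.len_measurable]) measurable

lemma measurable_coc_len1 [measurable]: "coc_len g \<in> measurable nuH (count_space UNIV)"
  using measurable_compose[OF _ measurable_coc_len, of "\<lambda>x. (g, x)" nuH] by simp

lemma measurable_act [measurable]: "act g \<in> measurable nuH nuH"
proof -
  have "(\<lambda>x. aG g x) \<in> measurable nuH Om"
    by (intro G.act_measurable H.dom_inclusion_measurable) auto
  then show ?thesis
    unfolding act_def using measurable_compose[OF _ H.pt_measurable] by blast
qed

text \<open>For fixed \<open>x\<close> the map sending \<open>h\<close> to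
  \<open>h - coc g x\<close> is a right translation, so the inner integral sees only the measure of
  \<open>U\<close>, whatever the cocycle is.\<close>

lemma nn_integral_shift:
  assumes [measurable]: "U \<in> sets borel" "f \<in> borel_measurable nuH" "F \<in> borel_measurable Om"
    and F: "\<And>x h. x \<in> space nuH \<Longrightarrow> F (aH h x) = indicator U (h - coc g x) * f x"
  shows "(\<integral>\<^sup>+w. F w \<partial>Om) = emeasure lamH U * (\<integral>\<^sup>+x. f x \<partial>nuH)"
proof -
  have "(\<integral>\<^sup>+w. F w \<partial>Om) = (\<integral>\<^sup>+x. \<integral>\<^sup>+h. F (aH h x) \<partial>lamH \<partial>nuH)"
    by (rule H.nn_integral_Om) measurable
  also have "\<dots> = (\<integral>\<^sup>+x. (\<integral>\<^sup>+h. f x * indicator U (h + - coc g x) \<partial>lamH) \<partial>nuH)"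
    by (intro nn_integral_cong) (simp add: F mult.commute)
  also have "\<dots> = (\<integral>\<^sup>+x. f x * emeasure lamH U \<partial>nuH)"
    by (subst H.nn_integral_translate_right) (auto simp: nn_integral_cmult_indicator)
  also have "\<dots> = emeasure lamH U * (\<integral>\<^sup>+x. f x \<partial>nuH)"
    by (simp add: nn_integral_multc mult.commute)
  finally show ?thesis .
qed

text \<open>Spread \<open>f\<close> over a slab above a ball \<open>U\<close> and integrate over
  \<open>Om\<close>. Acting by \<open>g\<close> leaves the integral unchanged, and in coordinates it
  replaces \<open>f\<close> by \<open>f\<close> composed with \<open>act g\<close>; the positive
  finite measure of \<open>U\<close> then cancels.\<close>

lemma nn_integral_act:
  assumes [measurable]: "f \<in> borel_measurable nuH"
  shows "(\<integral>\<^sup>+x. f (act g x) \<partial>nuH) = (\<integral>\<^sup>+x. f x \<partial>nuH)"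
proof -
  obtain n where n: "emeasure lamH (H.wball n) > 0"
    using H.wball_positive by blast
  define U where "U = H.wball n"
  have [measurable]: "U \<in> sets borel" and U: "emeasure lamH U > 0" "emeasure lamH U < \<infinity>"
    using n H.emeasure_wball unfolding U_def by auto
  let ?F = "\<lambda>w. indicator U (H.grp w) * f (H.pt w)"
  have "emeasure lamH U * (\<integral>\<^sup>+x. f (act g x) \<partial>nuH) = (\<integral>\<^sup>+w. ?F (aG g w) \<partial>Om)"
  proof (rule nn_integral_shift[symmetric])
    show "(\<lambda>w. ?F (aG g w)) \<in> borel_measurable Om"
      by (rule measurable_compose[OF G.act_measurable1]) measurable
    show "?F (aG g (aH h x)) = indicator U (h - coc g x) * f (act g x)" if "x \<in> space nuH" for x h
      using that by (simp add: aG_aH act_in)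
  qed measurable
  also have "\<dots> = (\<integral>\<^sup>+w. ?F w \<partial>Om)"
    by (rule G.nn_integral_Om_act) measurable
  also have "\<dots> = (\<integral>\<^sup>+x. \<integral>\<^sup>+h. ?F (aH h x) \<partial>lamH \<partial>nuH)"
    by (rule H.nn_integral_Om) measurable
  also have "\<dots> = (\<integral>\<^sup>+x. \<integral>\<^sup>+h. f x * indicator U h \<partial>lamH \<partial>nuH)"
    by (intro nn_integral_cong) (simp add: mult.commute)
  also have "\<dots> = emeasure lamH U * (\<integral>\<^sup>+x. f x \<partial>nuH)"
    by (simp add: nn_integral_cmult_indicator nn_integral_multc mult.commute)
  finally show ?thesis
    using U by (auto simp: ennreal_mult_cancel_left)
qed

end

section \<open>Comparison of the two growths by double counting\<close>

context coupling
begin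

lemma finite_nuH: "finite_measure nuH"
  using H.dom_finite by (intro finite_measureI) auto

lemma emeasure_nuH: "emeasure nuH A = ennreal (measure nuH A)"
  using finite_measure.emeasure_eq_measure[OF finite_nuH] .

lemma measure_nuH_pos: "measure nuH (space nuH) > 0"
  using H.dom_pos by (simp add: emeasure_nuH)

text \<open>Take a slab \<open>U * X\<^sub>H\<close> and cut it down to the part lying in a slab \<open>K * X\<^sub>G\<close>. Each \<open>g\<close> in the ball
of radius \<open>n\<close> pulls a definite part of it into the slab over the ball of radius \<open>R + m\<close> of \<open>H\<close>,
whereas each point is moved into \<open>K * X\<^sub>G\<close> only by a set of measure \<open>\<lambda>\<^sub>G(K)\<close>. Integrating over
\<open>g\<close> in both orders gives the bound.\<close>

lemma growth_comparison:
  "\<exists>C m. \<forall>n R.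
      (\<forall>g\<in>G.wball n. measure nuH {x \<in> space nuH. R \<le> coc_len g x} \<le> measure nuH (space nuH) / 4)
      \<longrightarrow> measure lamG (G.wball n) \<le> C * measure lamH (H.wball (R + m))"
proof -
  define v where "v = measure nuH (space nuH)"
  have v: "v > 0" unfolding v_def by (rule measure_nuH_pos)
  obtain m where m: "emeasure lamH (H.wball m) > 0"
    using H.wball_positive by blast
  define U where "U = H.wball m"
  define u where "u = measure lamH U"
  have U [measurable]: "U \<in> sets borel" unfolding U_def by measurable
  have eU: "emeasure lamH U = ennreal u"
    unfolding u_def U_def by (rule H.emeasure_wball_eq)
  have u: "u > 0" using m eU unfolding U_def by simp
  define Y where "Y j = {w \<in> space Om. H.grp w \<in> U \<and> G.grp w \<in> G.wball j}" for j
  have Y [measurable]: "Y j \<in> sets Om" for j unfolding Y_def by measurable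
  \<comment> \<open>The sets \<open>Y j\<close> exhaust the slab over \<open>U\<close>, of measure
    \<open>u * v\<close>. Some \<open>Y j\<close> has more than half of it, so losing a quarter of
    the slab to large cocycle values still leaves a quarter.\<close>
  have "(\<lambda>j. emeasure Om (Y j)) \<longlonglongrightarrow> emeasure Om (\<Union>j. Y j)"
    using G.incseq_wball by (intro Lim_emeasure_incseq) (auto simp: Y_def incseq_def)
  also have "(\<Union>j. Y j) = {w \<in> space Om. H.grp w \<in> U}"
    using G.UN_wball unfolding Y_def by blast
  also have "emeasure Om \<dots> = ennreal (u * v)"
    using u v by (simp add: H.emeasure_slab eU emeasure_nuH v_def ennreal_mult)
  finally have "(\<lambda>j. emeasure Om (Y j)) \<longlonglongrightarrow> ennreal (u * v)" .
  moreover have "ennreal (u * v / 2) < ennreal (u * v)"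
    using u v by (intro ennreal_lessI) auto
  ultimately have "\<forall>\<^sub>F j in sequentially. ennreal (u * v / 2) < emeasure Om (Y j)"
    by (rule order_tendstoD(1))
  then obtain j where j: "ennreal (u * v / 2) < emeasure Om (Y j)"
    unfolding eventually_sequentially by auto
  define K where "K = G.wball j"
  define k where "k = measure lamG K"
  have K [measurable]: "K \<in> sets borel" unfolding K_def by measurable
  have eK: "emeasure lamG K = ennreal k"
    unfolding k_def K_def by (rule G.emeasure_wball_eq)
  show ?thesis
  proof (intro exI allI impI)
    fix n R
    assume hyp: "\<forall>g\<in>G.wball n.
        measure nuH {x \<in> space nuH. R \<le> coc_len g x} \<le> measure nuH (space nuH) / 4"
    define Z where "Z = {w \<in> space Om. H.grp w \<in> H.wball (R + m)}"
    have Z [measurable]: "Z \<in> sets Om" unfolding Z_def by measurable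
    define I where "I g = (\<integral>\<^sup>+w. indicator (Y j) (aG g w) * indicator Z w \<partial>Om)" for g
    have I: "ennreal (u * v / 4) \<le> I g" if g: "g \<in> G.wball n" for g
    proof -
      note G.act_measurable1[measurable]
      let ?T = "{x \<in> space nuH. R \<le> coc_len g x}"
      let ?B = "\<lambda>w. indicator U (H.grp (aG g w)) * indicator ?T (H.pt w) :: ennreal"
      have "ennreal (u * v / 2) \<le> emeasure Om (Y j)" using j by simp
      also have "\<dots> = (\<integral>\<^sup>+w. indicator (Y j) w \<partial>Om)" by simp
      also have "\<dots> = (\<integral>\<^sup>+w. indicator (Y j) (aG g w) \<partial>Om)"
        by (rule G.nn_integral_Om_act[symmetric]) measurable
      \<comment> \<open>A point with coordinates \<open>(h, x)\<close> sent into \<open>Y j\<close>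
        has \<open>h - coc g x\<close> in \<open>U\<close>. If \<open>coc g x\<close> is shorter
        than \<open>R\<close>, then \<open>h\<close> has length at most \<open>R + m\<close> and the
        point is in \<open>Z\<close>; the remaining points are counted by \<open>?B\<close>.\<close>
      also have "\<dots> \<le> (\<integral>\<^sup>+w. (indicator (Y j) (aG g w) * indicator Z w + ?B w) \<partial>Om)"
      proof (rule nn_integral_mono)
        fix w assume w: "w \<in> space Om"
        define h x where "h = H.grp w" and "x = H.pt w"
        have x: "x \<in> space nuH" and hx: "w = aH h x"
          using w by (simp_all add: h_def x_def H.pt_in H.decomp)
        have grp: "H.grp (aG g w) = h - coc g x"
          unfolding hx using x by (simp add: aG_aH act_in)
        have "w \<in> Z" if "h - coc g x \<in> U" "coc_len g x < R"
        proof -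
          have "H.len ((h - coc g x) + coc g x) \<le> H.len (h - coc g x) + coc_len g x"
            by (rule H.len_add)
          also have "\<dots> \<le> R + m"
            using that unfolding U_def H.wball_def by simp
          finally show ?thesis
            using w unfolding Z_def H.wball_def h_def by simp
        qed
        then show "indicator (Y j) (aG g w) \<le> indicator (Y j) (aG g w) * indicator Z w + ?B w"
          using x grp unfolding Y_def x_def[symmetric]
          by (auto simp: indicator_def)
      qed
      also have "\<dots> = I g + (\<integral>\<^sup>+w. ?B w \<partial>Om)"
        unfolding I_def by (rule nn_integral_add) measurable
      also have "(\<integral>\<^sup>+w. ?B w \<partial>Om) = emeasure lamH U * (\<integral>\<^sup>+x. indicator ?T x \<partial>nuH)"
        by (rule nn_integral_shift[where g = g]) (auto simp: aG_aH act_in)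
      also have "\<dots> \<le> ennreal (u * v / 4)"
      proof -
        have "(\<integral>\<^sup>+x. indicator ?T x \<partial>nuH) \<le> ennreal (v / 4)"
          using hyp g by (simp add: emeasure_nuH v_def)
        then have "emeasure lamH U * (\<integral>\<^sup>+x. indicator ?T x \<partial>nuH) \<le> ennreal u * ennreal (v / 4)"
          unfolding eU by (intro mult_left_mono) auto
        then show ?thesis
          using u v by (simp add: ennreal_mult[symmetric])
      qed
      finally have "ennreal (u * v / 2) \<le> I g + ennreal (u * v / 4)"
        by (simp add: add_left_mono)
      then show ?thesis
        using u v by (cases "I g") (auto simp: ennreal_plus[symmetric] simp del: ennreal_plus)
    qed
    interpret lamG: sigma_finite_measure lamG by (rule G.sigma_finite)
    interpret Om: sigma_finite_measure Om by (rule G.sigma_finite_Om)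
    interpret pair_sigma_finite lamG Om ..
    have [measurable]: "(\<lambda>p. aG (fst p) (snd p)) \<in> measurable (lamG \<Otimes>\<^sub>M Om) Om"
      using G.action unfolding mp_action_def by blast
    have "ennreal (u * v / 4) * emeasure lamG (G.wball n) =
        (\<integral>\<^sup>+g. ennreal (u * v / 4) * indicator (G.wball n) g \<partial>lamG)"
      by (simp add: nn_integral_cmult_indicator)
    also have "\<dots> \<le> (\<integral>\<^sup>+g. I g \<partial>lamG)"
      using I by (intro nn_integral_mono) (auto simp: indicator_def)
    also have "\<dots> = (\<integral>\<^sup>+w. \<integral>\<^sup>+g. indicator (Y j) (aG g w) * indicator Z w \<partial>lamG \<partial>Om)"
      unfolding I_def by (rule Fubini'[symmetric]) (simp add: case_prod_beta)
    also have "\<dots> \<le> (\<integral>\<^sup>+w. ennreal k * indicator Z w \<partial>Om)"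
    proof (rule nn_integral_mono)
      fix w assume w: "w \<in> space Om"
      \<comment> \<open>The \<open>G\<close>-coordinate of \<open>aG g w\<close> is
        \<open>g + G.grp w\<close>, so right invariance of \<open>lamG\<close> bounds the set of
        admissible \<open>g\<close> by the measure of \<open>K\<close>, uniformly in
        \<open>w\<close>.\<close>
      have "(\<integral>\<^sup>+g. indicator (Y j) (aG g w) * indicator Z w \<partial>lamG) \<le>
          (\<integral>\<^sup>+g. indicator K (g + G.grp w) * indicator Z w \<partial>lamG)"
        using w by (intro nn_integral_mono mult_right_mono)
          (auto simp: Y_def K_def indicator_def G.grp_act)
      also have "\<dots> = (\<integral>\<^sup>+g. indicator K g * indicator Z w \<partial>lamG)"
        by (rule G.nn_integral_translate_right) measurable
      also have "\<dots> = ennreal k * indicator Z w"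
        by (simp add: nn_integral_multc eK)
      finally show "(\<integral>\<^sup>+g. indicator (Y j) (aG g w) * indicator Z w \<partial>lamG) \<le> ennreal k * indicator Z w" .
    qed
    also have "\<dots> = ennreal k * (emeasure lamH (H.wball (R + m)) * ennreal v)"
      unfolding Z_def by (subst nn_integral_cmult_indicator) (auto simp: H.emeasure_slab emeasure_nuH v_def)
    finally have "ennreal (u * v / 4 * measure lamG (G.wball n)) \<le> ennreal (k * (measure lamH (H.wball (R + m)) * v))"
      using u v unfolding G.emeasure_wball_eq H.emeasure_wball_eq
      by (simp only: ennreal_mult'[symmetric] k_def measure_nonneg mult_nonneg_nonneg
          divide_nonneg_pos less_imp_le zero_less_numeral)
    then have "u * v / 4 * measure lamG (G.wball n) \<le> k * (measure lamH (H.wball (R + m)) * v)"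
      using v by (subst (asm) ennreal_le_iff) (auto simp: k_def)
    \<comment> \<open>The constant depends only on \<open>U\<close> and \<open>K\<close>, both fixed
      before \<open>n\<close> and \<open>R\<close>.\<close>
    then show "measure lamG (G.wball n) \<le> (4 * k / u) * measure lamH (H.wball (R + m))"
      using u v by (simp add: field_simps)
  qed
qed

section \<open>Truncated means of the cocycle length and tail bounds\<close>

definition trunc_mean :: "nat \<Rightarrow> 'g \<Rightarrow> ennreal" where
  "trunc_mean R g = (\<integral>\<^sup>+x. of_nat (min (coc_len g x) R) \<partial>nuH)"

lemma trunc_mean_zero: "trunc_mean R 0 = 0"
proof -
  have "trunc_mean R 0 = (\<integral>\<^sup>+x. 0 \<partial>nuH)"
    unfolding trunc_mean_def by (intro nn_integral_cong) (simp add: coc_zero)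
  then show ?thesis by simp
qed

text \<open>Truncation at \<open>R\<close> preserves subadditivity, and invariance of
  \<open>nuH\<close> under \<open>act h\<close> removes the shift of the base point that the cocycle
  identity introduces.\<close>

lemma trunc_mean_add: "trunc_mean R (g + h) \<le> trunc_mean R g + trunc_mean R h"
proof -
  have "trunc_mean R (g + h) \<le>
      (\<integral>\<^sup>+x. (of_nat (min (coc_len g (act h x)) R) + of_nat (min (coc_len h x) R)) \<partial>nuH)"
    unfolding trunc_mean_def
  proof (rule nn_integral_mono)
    fix x assume "x \<in> space nuH"
    then have "min (coc_len (g + h) x) R \<le> min (coc_len g (act h x)) R + min (coc_len h x) R"
      using coc_len_add[of x g h] by linarith
    then show "(of_nat (min (coc_len (g + h) x) R) :: ennreal) \<le>
        of_nat (min (coc_len g (act h x)) R) + of_nat (min (coc_len h x) R)"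
      unfolding of_nat_add[symmetric] by (rule of_nat_mono)
  qed
  also have "\<dots> = (\<integral>\<^sup>+x. of_nat (min (coc_len g (act h x)) R) \<partial>nuH) + trunc_mean R h"
    unfolding trunc_mean_def by (rule nn_integral_add) measurable
  also have "(\<integral>\<^sup>+x. of_nat (min (coc_len g (act h x)) R) \<partial>nuH) = trunc_mean R g"
    unfolding trunc_mean_def by (rule nn_integral_act) measurable
  finally show ?thesis .
qed

lemma trunc_mean_measurable: "trunc_mean R \<in> borel_measurable borel"
proof -
  interpret finite_measure nuH by (rule finite_nuH)
  note measurable_coc_len[measurable]
  show ?thesis
    unfolding trunc_mean_def
    by (rule borel_measurable_nn_integral) (simp add: case_prod_beta)
qed

lemma trunc_mean_markov:
  "ennreal (real R * measure nuH {x \<in> space nuH. R \<le> coc_len g x}) \<le> trunc_mean R g"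
proof -
  have "ennreal (real R * measure nuH {x \<in> space nuH. R \<le> coc_len g x}) =
      (\<integral>\<^sup>+x. of_nat R * indicator {x \<in> space nuH. R \<le> coc_len g x} x \<partial>nuH)"
    by (subst nn_integral_cmult_indicator)
      (auto simp: emeasure_nuH ennreal_mult ennreal_of_nat_eq_real_of_nat)
  also have "\<dots> \<le> trunc_mean R g"
    unfolding trunc_mean_def by (intro nn_integral_mono) (auto simp: indicator_def)
  finally show ?thesis .
qed

text \<open>The truncated means rescaled by \<open>p (r j) / r j\<close> tend to 0 on generators by
  dominated convergence, on every element by subadditivity, and then uniformly on \<open>SG\<close>.
  An element of the ball of radius \<open>n\<close> costs at most \<open>n\<close> such small terms,
  and Markov's inequality converts the sum into the tail bound.\<close>

lemma tail_estimate:
  fixes p :: "nat \<Rightarrow> real" and r :: "nat \<Rightarrow> nat"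
  assumes r0: "\<And>j. r j \<ge> t0" and "t0 > 0"
    and pos: "\<And>k. k \<ge> t0 \<Longrightarrow> p k > 0"
    and rec: "\<And>j k. t0 \<le> k \<Longrightarrow> k \<le> r j \<Longrightarrow> p (r j) / r j \<le> p k / k"
    and mono: "\<And>k l. t0 \<le> k \<Longrightarrow> k \<le> l \<Longrightarrow> p k \<le> p l"
    and lim: "(\<lambda>j. p (r j) / r j) \<longlonglongrightarrow> 0"
    and int: "\<And>s. s \<in> SG \<Longrightarrow> (\<integral>\<^sup>+x. ennreal (p (coc_len s x)) \<partial>nuH) < \<infinity>"
    and N: "N > 0"
  shows "\<exists>j0. \<forall>j\<ge>j0. \<forall>n. real n \<le> N * p (r j) \<longrightarrow>
    (\<forall>g\<in>G.wball n. measure nuH {x \<in> space nuH. r j \<le> coc_len g x} \<le> measure nuH (space nuH) / 4)"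
proof -
  define c where "c j = p (r j) / r j" for j
  have c: "c j > 0" for j
    unfolding c_def using pos[OF r0] r0[of j] \<open>t0 > 0\<close> by simp
  define u where "u j g = ennreal (c j) * trunc_mean (r j) g" for j g
  have u0: "u j 0 = 0" for j
    by (simp add: u_def trunc_mean_zero)
  have uadd: "u j (g + h) \<le> u j g + u j h" for j g h
    unfolding u_def distrib_left[symmetric] by (intro mult_left_mono trunc_mean_add) simp
  have lim_s: "(\<lambda>j. u j s) \<longlonglongrightarrow> 0" if s: "s \<in> SG" for s
  proof -
    let ?f = "\<lambda>j x. ennreal (c j * real (min (coc_len s x) (r j)))"
    have u_eq: "u j s = (\<integral>\<^sup>+x. ?f j x \<partial>nuH)" for j
      unfolding u_def trunc_mean_def using c[of j]
      by (subst nn_integral_cmult[symmetric]) (auto simp: ennreal_mult ennreal_of_nat_eq_real_of_nat)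
    have "(\<lambda>j. \<integral>\<^sup>+x. ?f j x \<partial>nuH) \<longlonglongrightarrow> (\<integral>\<^sup>+x. 0 \<partial>nuH)"
    proof (rule nn_integral_dominated_convergence)
      show "(\<integral>\<^sup>+x. (ennreal (p t0) + ennreal (p (coc_len s x))) \<partial>nuH) < \<infinity>"
        using int[OF s] H.dom_finite
        by (subst nn_integral_add) (auto simp: ennreal_mult_less_top)
      \<comment> \<open>Three ranges of the length \<open>X\<close>: below \<open>t0\<close> the
        record property at \<open>t0\<close> gives the bound \<open>p t0\<close>; from
        \<open>t0\<close> to \<open>r j\<close> the record property at \<open>X\<close> gives
        \<open>p X\<close>; above \<open>r j\<close> the truncated value is exactly
        \<open>p (r j)\<close>, and monotonicity applies.\<close>
      show "AE x in nuH. ?f j x \<le> ennreal (p t0) + ennreal (p (coc_len s x))" for j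
      proof (rule AE_I2)
        fix x
        define X where "X = coc_len s x"
        show "?f j x \<le> ennreal (p t0) + ennreal (p (coc_len s x))"
        proof (cases "X < t0")
          case True
          have "c j * real (min X (r j)) \<le> p t0 / t0 * t0"
            using True c[of j] rec[OF order_refl r0, of j] pos[of t0] \<open>t0 > 0\<close>
            by (intro mult_mono) (auto simp: c_def)
          then have "?f j x \<le> ennreal (p t0)"
            using \<open>t0 > 0\<close> by (intro ennreal_leI) (simp add: X_def)
          then show ?thesis
            using add_increasing2[of "ennreal (p (coc_len s x))"] by auto
        next
          case False
          have "c j * real (min X (r j)) \<le> p X"
          proof (cases "X \<le> r j")
            case True
            then have "c j * X \<le> p X / X * X"
              using rec[of X j] False unfolding c_def by (intro mult_right_mono) auto
            then show ?thesis
              using True False \<open>t0 > 0\<close> by simp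
          next
            case False
            then show ?thesis
              using mono[OF r0, of j X] r0[of j] \<open>t0 > 0\<close> by (simp add: c_def)
          qed
          then have "?f j x \<le> ennreal (p (coc_len s x))"
            by (intro ennreal_leI) (simp add: X_def)
          then show ?thesis
            using add_increasing[of "ennreal (p t0)"] by auto
        qed
      qed
      show "AE x in nuH. (\<lambda>j. ?f j x) \<longlonglongrightarrow> 0"
      proof (rule AE_I2)
        fix x
        have "(\<lambda>j. c j * real (coc_len s x)) \<longlonglongrightarrow> 0 * real (coc_len s x)"
          using lim unfolding c_def by (intro tendsto_mult tendsto_const)
        then have upper: "(\<lambda>j. c j * real (coc_len s x)) \<longlonglongrightarrow> 0"
          by simp
        have "(\<lambda>j. c j * real (min (coc_len s x) (r j))) \<longlonglongrightarrow> 0"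
          by (rule tendsto_sandwich[OF _ _ tendsto_const upper])
            (auto intro!: always_eventually mult_left_mono simp: less_imp_le[OF c])
        from tendsto_ennrealI[OF this] show "(\<lambda>j. ?f j x) \<longlonglongrightarrow> 0"
          by simp
      qed
    qed measurable
    then show ?thesis by (simp add: u_eq)
  qed
  have lim_g: "(\<lambda>j. u j g) \<longlonglongrightarrow> 0" for g
  proof -
    have "(\<lambda>j. u j g) \<longlonglongrightarrow> 0" if "g \<in> set_pow SG k" for k
      using that
    proof (induction k arbitrary: g)
      case 0
      then show ?case by (simp add: u0)
    next
      case (Suc k)
      then obtain a s where g: "g = a + s" and a: "a \<in> set_pow SG k" and s: "s \<in> SG" by auto
      have "(\<lambda>j. u j a + u j s) \<longlonglongrightarrow> 0 + 0"
        by (intro tendsto_add Suc.IH a lim_s s)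
      then have upper: "(\<lambda>j. u j a + u j s) \<longlonglongrightarrow> 0"
        by simp
      show ?case
        unfolding g by (rule tendsto_sandwich[OF _ _ tendsto_const upper]) (auto simp: uadd)
    qed
    then show ?thesis using G.in_set_pow_len by blast
  qed
  define v where "v = measure nuH (space nuH)"
  have v: "v > 0" unfolding v_def by (rule measure_nuH_pos)
  have "u j \<in> borel_measurable borel" for j
    unfolding u_def using trunc_mean_measurable[measurable] by measurable
  \<comment> \<open>With \<open>v / (8 * N)\<close> the uniform bound per generator is
    \<open>v / (4 * N)\<close>. Summed over at most \<open>N * p (r j)\<close> generators this is
    \<open>p (r j) * v / 4\<close>, the quarter required by
    \<open>growth_comparison\<close>.\<close>
  then have "\<exists>j0. \<forall>j\<ge>j0. \<forall>s\<in>SG. u j s \<le> 2 * ennreal (v / (8 * N))"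
    using uadd lim_g v N by (intro G.subadditive_tendsto_uniform) auto
  then obtain j0 where j0: "\<And>j s. j \<ge> j0 \<Longrightarrow> s \<in> SG \<Longrightarrow> u j s \<le> 2 * ennreal (v / (8 * N))"
    by blast
  have "measure nuH {x \<in> space nuH. r j \<le> coc_len g x} \<le> v / 4"
    if j: "j \<ge> j0" and n: "real n \<le> N * p (r j)" and g: "g \<in> G.wball n" for j n g
  proof -
    define q where "q = measure nuH {x \<in> space nuH. r j \<le> coc_len g x}"
    obtain k where k: "k \<le> n" "g \<in> set_pow SG k"
      using g unfolding G.wball_eq by auto
    have "ennreal (c j) * ennreal (r j * q) \<le> u j g"
      unfolding u_def q_def by (intro mult_left_mono trunc_mean_markov) simp
    also have "\<dots> \<le> of_nat k * (2 * ennreal (v / (8 * N)))"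
      using G.set_pow_subadditive_bound[of "u j", OF u0 uadd j0[OF j] k(2)] by blast
    also have "\<dots> = ennreal (real k * (v / (4 * N)))"
      using v N by (simp add: ennreal_of_nat_eq_real_of_nat ennreal_mult'[symmetric]
          flip: ennreal_numeral)
    finally have "ennreal (c j * (r j * q)) \<le> ennreal (real k * (v / (4 * N)))"
      using c[of j] by (simp add: ennreal_mult' less_imp_le)
    then have "c j * (r j * q) \<le> real k * (v / (4 * N))"
      using v N by (subst (asm) ennreal_le_iff) auto
    also have "\<dots> \<le> (N * p (r j)) * (v / (4 * N))"
      using k(1) n v N by (intro mult_right_mono) auto
    also have "c j * (r j * q) = p (r j) * q"
      using r0[of j] \<open>t0 > 0\<close> by (simp add: c_def)
    finally have "p (r j) * q \<le> p (r j) * (v / 4)"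
      using N by (simp add: field_simps)
    then show ?thesis
      using pos[OF r0, of j] unfolding q_def by simp
  qed
  then show ?thesis unfolding v_def by blast
qed

end

section \<open>Inverse functions at infinity and record minima\<close>

lemma strict_mono_filterlim_at_top:
  fixes f :: "real \<Rightarrow> real"
  assumes "strict_mono f" "\<forall>\<^sub>F t in at_top. t \<in> range f"
  shows "filterlim f at_top at_top"
  unfolding filterlim_at_top
proof
  fix Z
  have "\<forall>\<^sub>F t in at_top. t \<in> range f \<and> Z \<le> t"
    using assms(2) eventually_ge_at_top[of Z] by (rule eventually_conj)
  from eventually_happens[OF this] obtain s where s: "Z \<le> f s"
    by auto
  show "\<forall>\<^sub>F x in at_top. Z \<le> f x"
    using eventually_ge_at_top[of s]
  proof eventually_elim
    case (elim x)
    then have "f s \<le> f x" using assms(1) by (simp add: strict_mono_less_eq)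
    then show ?case using s by simp
  qed
qed

text \<open>Off the range of \<open>f\<close> the value of \<open>inv f\<close> is unspecified.
  Eventual surjectivity gives \<open>f (inv f t) = t\<close> for large \<open>t\<close>, and the
  comparison is made after applying \<open>f\<close>.\<close>

lemma strict_mono_inv_at_top:
  fixes f :: "real \<Rightarrow> real"
  assumes "strict_mono f" "\<forall>\<^sub>F t in at_top. t \<in> range f"
  shows "filterlim (inv f) at_top at_top"
  unfolding filterlim_at_top
proof
  fix Z
  show "\<forall>\<^sub>F t in at_top. Z \<le> inv f t"
    using assms(2) eventually_ge_at_top[of "f Z"]
  proof eventually_elim
    case (elim t)
    then have "f Z \<le> f (inv f t)" by (simp add: f_inv_into_f)
    then show ?case using assms(1) by (simp add: strict_mono_less_eq)
  qed
qed

text \<open>Given \<open>M\<close>, let \<open>m\<close> be the positive minimum of \<open>a\<close>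
  from \<open>t0\<close> up to \<open>max t0 M\<close>. The first index from \<open>t0\<close> on
  where \<open>a\<close> drops below \<open>m\<close> exists by convergence to 0; it is a record and
  lies beyond \<open>M\<close>. Hence records are infinite in number and can be enumerated.\<close>

lemma record_minima:
  fixes a :: "nat \<Rightarrow> real"
  assumes pos: "\<And>k. k \<ge> t0 \<Longrightarrow> a k > 0" and lim: "a \<longlonglongrightarrow> 0"
  shows "\<exists>r::nat \<Rightarrow> nat. strict_mono r \<and>
    (\<forall>j. r j \<ge> t0 \<and> (\<forall>k. t0 \<le> k \<longrightarrow> k \<le> r j \<longrightarrow> a (r j) \<le> a k))"
proof -
  define Rec where "Rec = {n. n \<ge> t0 \<and> (\<forall>k. t0 \<le> k \<longrightarrow> k \<le> n \<longrightarrow> a n \<le> a k)}"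
  have "\<exists>n>M. n \<in> Rec" for M
  proof -
    define m where "m = Min (a ` {t0..max t0 M})"
    have m: "m \<le> a k" if "t0 \<le> k" "k \<le> max t0 M" for k
      unfolding m_def using that by (intro Min_le) auto
    have "m \<in> a ` {t0..max t0 M}"
      unfolding m_def by (intro Min_in) auto
    then have "m > 0" using pos by auto
    then have "\<forall>\<^sub>F k in sequentially. a k < m \<and> k \<ge> t0"
      using lim by (intro eventually_conj order_tendstoD(2) eventually_ge_at_top)
    then have ex: "\<exists>k. a k < m \<and> k \<ge> t0"
      unfolding eventually_sequentially by auto
    define n where "n = (LEAST k. a k < m \<and> k \<ge> t0)"
    have n: "a n < m" "n \<ge> t0"
      using LeastI_ex[OF ex] unfolding n_def by auto
    have "a n \<le> a k" if "t0 \<le> k" "k \<le> n" for k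
    proof (cases "k = n")
      case False
      then have "\<not> (a k < m \<and> k \<ge> t0)"
        using that(2) unfolding n_def by (intro not_less_Least) simp
      then show ?thesis using n that by simp
    qed simp
    moreover have "n > M"
      using m[of n] n by (cases "n \<le> M") auto
    ultimately show ?thesis unfolding Rec_def using n by auto
  qed
  then have inf: "infinite Rec"
    unfolding infinite_nat_iff_unbounded by blast
  have "enumerate Rec j \<ge> t0 \<and>
      (\<forall>k. t0 \<le> k \<longrightarrow> k \<le> enumerate Rec j \<longrightarrow> a (enumerate Rec j) \<le> a k)" for j
  proof -
    have "enumerate Rec j \<in> {n. n \<ge> t0 \<and> (\<forall>k. t0 \<le> k \<longrightarrow> k \<le> n \<longrightarrow> a n \<le> a k)}"
      using enumerate_in_set[OF inf] by (simp only: Rec_def)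
    then show ?thesis by (rule CollectD)
  qed
  then show ?thesis
    using strict_mono_enumerate[OF inf] by blast
qed

section \<open>From integrability to an inequality between volume growths\<close>

lemma (in haar_group) vol_growth_eq: "t \<ge> 0 \<Longrightarrow> vol_growth lam S t = measure lam (wball (nat \<lfloor>t\<rfloor>))"
  unfolding vol_growth_def wball_def
  by (intro arg_cong[where f = "measure lam"]) (auto simp: le_nat_iff le_floor_iff)

lemma (in haar_group) measure_wball_mono: "m \<le> n \<Longrightarrow> measure lam (wball m) \<le> measure lam (wball n)"
  using emeasure_wball[of n]
  by (intro measure_mono_fmeasurable wball_mono) (auto intro!: fmeasurableI)

text \<open>The order of quantifiers matters: \<open>C\<close> and \<open>r\<close> come before
  \<open>N\<close>, since the final contradiction takes an \<open>N\<close> that depends on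
  \<open>C\<close>.\<close>

lemma (in coupling) integrable_growth:
  fixes \<phi> :: "real \<Rightarrow> real"
  assumes mono: "\<And>s t. T \<le> s \<Longrightarrow> s \<le> t \<Longrightarrow> \<phi> s \<le> \<phi> t"
    and top: "filterlim \<phi> at_top at_top"
    and sub: "((\<lambda>t. \<phi> t / t) \<longlongrightarrow> 0) at_top"
    and int: "phi_L0_integrable \<phi> SG SH aG aH nuH"
  shows "\<exists>C>0. \<exists>r::nat \<Rightarrow> nat. strict_mono r \<and>
    (\<forall>N>0. \<forall>\<^sub>F j in sequentially.
      vol_growth lamG SG (N * \<phi> (r j)) \<le> C * vol_growth lamH SH (2 * real (r j)))"
proof -
  define p where "p k = \<phi> (real k)" for k
  have "\<forall>\<^sub>F t in at_top. \<phi> t > 0 \<and> t \<ge> T \<and> t > 0"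
    using top by (intro eventually_conj eventually_ge_at_top eventually_gt_at_top)
      (auto simp: filterlim_at_top_dense)
  then obtain T' where T': "\<And>t. t \<ge> T' \<Longrightarrow> \<phi> t > 0 \<and> t \<ge> T \<and> t > 0"
    unfolding eventually_at_top_linorder by blast
  define t0 where "t0 = nat \<lceil>T'\<rceil>"
  have t0: "p k > 0 \<and> real k \<ge> T \<and> k > 0" if "k \<ge> t0" for k
  proof -
    have "real k \<ge> T'" using that unfolding t0_def by linarith
    then show ?thesis using T'[of "real k"] unfolding p_def by auto
  qed
  have pmono: "p k \<le> p l" if "t0 \<le> k" "k \<le> l" for k l
    unfolding p_def using t0[OF that(1)] that(2) by (intro mono) auto
  have lim: "(\<lambda>k. p k / real k) \<longlonglongrightarrow> 0"
    unfolding p_def by (rule filterlim_compose[OF sub filterlim_real_sequentially])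
  obtain r where r: "strict_mono (r :: nat \<Rightarrow> nat)" "\<And>j. r j \<ge> t0"
    and rec: "\<And>j k. t0 \<le> k \<Longrightarrow> k \<le> r j \<Longrightarrow> p (r j) / real (r j) \<le> p k / real k"
    using record_minima[OF _ lim, of t0] t0 by auto
  have fin: "(\<integral>\<^sup>+x. ennreal (p (coc_len s x)) \<partial>nuH) < \<infinity>" if "s \<in> SG" for s
  proof -
    have "(\<integral>\<^sup>+x. ennreal (p (coc_len s x)) \<partial>nuH) =
        (\<integral>\<^sup>+x. ennreal (\<phi> (real (word_len SH (cocycle aG aH nuH s x)))) \<partial>nuH)"
      by (intro nn_integral_cong) (simp add: p_def cocycle_eq)
    also have "\<dots> \<le> (SUP g\<in>SG. \<integral>\<^sup>+ x. ennreal (\<phi> (real (word_len SH (cocycle aG aH nuH g x)))) \<partial>nuH)"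
      using that by (rule SUP_upper)
    also have "\<dots> < \<infinity>" using int unfolding phi_L0_integrable_def .
    finally show ?thesis .
  qed
  obtain C m where Cm: "\<And>n R.
      (\<forall>g\<in>G.wball n. measure nuH {x \<in> space nuH. R \<le> coc_len g x} \<le> measure nuH (space nuH) / 4)
      \<Longrightarrow> measure lamG (G.wball n) \<le> C * measure lamH (H.wball (R + m))"
    using growth_comparison by blast
  have "\<forall>\<^sub>F j in sequentially.
      vol_growth lamG SG (N * \<phi> (r j)) \<le> max C 1 * vol_growth lamH SH (2 * real (r j))"
    if N: "N > 0" for N
  proof -
    have "\<exists>j0. \<forall>j\<ge>j0. \<forall>n. real n \<le> N * p (r j) \<longrightarrow>
      (\<forall>g\<in>G.wball n. measure nuH {x \<in> space nuH. r j \<le> coc_len g x} \<le> measure nuH (space nuH) / 4)"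
    proof (rule tail_estimate)
      show "(\<lambda>j. p (r j) / real (r j)) \<longlonglongrightarrow> 0"
        using LIMSEQ_subseq_LIMSEQ[OF lim r(1)] by (simp add: comp_def)
      show "t0 > 0" using t0[of t0] by simp
    qed (use r rec t0 pmono fin N in auto)
    then have "\<forall>\<^sub>F j in sequentially. \<forall>n. real n \<le> N * p (r j) \<longrightarrow>
      (\<forall>g\<in>G.wball n. measure nuH {x \<in> space nuH. r j \<le> coc_len g x} \<le> measure nuH (space nuH) / 4)"
      unfolding eventually_sequentially .
    then show ?thesis
      using eventually_ge_at_top[of m]
    proof eventually_elim
      case (elim j)
      define n where "n = nat \<lfloor>N * p (r j)\<rfloor>"
      have Np: "N * p (r j) \<ge> 0" using N t0[OF r(2), of j] by simp
      then have "real n \<le> N * p (r j)" unfolding n_def by linarith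
      have "vol_growth lamG SG (N * \<phi> (r j)) = measure lamG (G.wball n)"
        using Np unfolding n_def p_def by (rule G.vol_growth_eq)
      also have "\<dots> \<le> C * measure lamH (H.wball (r j + m))"
        using elim \<open>real n \<le> N * p (r j)\<close> by (intro Cm) auto
      \<comment> \<open>Strict monotonicity of \<open>r\<close> gives
        \<open>m \<le> j \<le> r j\<close>, so doubling the radius absorbs \<open>m\<close>. The
        maximum with 1 makes the constant positive.\<close>
      also have "\<dots> \<le> max C 1 * measure lamH (H.wball (2 * r j))"
        using elim(2) strict_mono_imp_increasing[OF r(1), of j]
        by (intro mult_mono H.measure_wball_mono) auto
      also have "measure lamH (H.wball (2 * r j)) = vol_growth lamH SH (2 * real (r j))"
      proof -
        have "nat \<lfloor>2 * real (r j)\<rfloor> = 2 * r j" by linarith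
        then show ?thesis by (simp add: H.vol_growth_eq)
      qed
      finally show ?case .
    qed
  qed
  then show ?thesis
    using r(1) by (intro exI[of _ "max C 1"] conjI exI[of _ r]) auto
qed

section \<open>Contradiction with the asymptotics of \<open>fG\<close> and \<open>fH\<close>\<close>

theorem theoremE:
  fixes lamG :: "'g::{group_add,t2_space,second_countable_topology} measure"
    and lamH :: "'h::{group_add,t2_space,second_countable_topology} measure"
    and SG :: "'g set" and SH :: "'h set"
    and fG fH :: "real \<Rightarrow> real"
  assumes "lcsc_group TYPE('g)" and "lcsc_group TYPE('h)"
    and "non_discrete TYPE('g)" and "non_discrete TYPE('h)"
    and "unimodular_haar lamG" and "unimodular_haar lamH"
    and "compact_generating SG" and "compact_generating SH"
    and "strict_mono fG" and "strict_mono fH"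
    and "\<forall>\<^sub>F t in at_top. t \<in> range fG" and "\<forall>\<^sub>F t in at_top. t \<in> range fH"
    and "asym_eq fG (vol_growth lamG SG)" and "asym_eq fH (vol_growth lamH SH)"
    and "(\<lambda>t. inv fG t) \<in> o[at_top](\<lambda>t. inv fH t)"
    and "\<forall>C>0. (\<lambda>t. inv fG (C * t)) \<in> O[at_top](\<lambda>t. inv fG t)"
    and "\<forall>C>0. (\<lambda>t. inv fG (fH (C * t))) \<in> O[at_top](\<lambda>t. inv fG (fH t))"
  shows "\<not> (\<exists>(Om :: 'w measure) aG aH nuG nuH.
            me_coupling lamG lamH Om aG aH nuG nuH \<and>
            phi_L0_integrable (\<lambda>t. inv fG (fH t)) SG SH aG aH nuH)"
proof
  assume "\<exists>(Om :: 'w measure) aG aH nuG nuH.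
            me_coupling lamG lamH Om aG aH nuG nuH \<and>
            phi_L0_integrable (\<lambda>t. inv fG (fH t)) SG SH aG aH nuH"
  then obtain Om :: "'w measure" and aG aH nuG nuH
    where me: "me_coupling lamG lamH Om aG aH nuG nuH"
      and int: "phi_L0_integrable (\<lambda>t. inv fG (fH t)) SG SH aG aH nuH"
    by blast
  interpret coupling lamG SG lamH SH Om aG aH nuG nuH
    using me assms(1,2,5-8) unfolding me_coupling_def by unfold_locales auto
  define \<phi> where "\<phi> t = inv fG (fH t)" for t
  note mG = assms(9) and mH = assms(10)
  have fH_top: "filterlim fH at_top at_top"
    by (rule strict_mono_filterlim_at_top) fact+
  have fG_top: "filterlim fG at_top at_top"
    by (rule strict_mono_filterlim_at_top) fact+
  have invG_top: "filterlim (inv fG) at_top at_top"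
    by (rule strict_mono_inv_at_top) fact+
  have \<phi>_top: "filterlim \<phi> at_top at_top"
    unfolding \<phi>_def by (rule filterlim_compose[OF invG_top fH_top])
  have inv_fG: "inv fG (fG s) = s" and inv_fH: "inv fH (fH s) = s" for s
    using mG mH by (simp_all add: strict_mono_imp_inj_on inv_f_f)
  have fG_le: "fG s \<le> fG t \<longleftrightarrow> s \<le> t" for s t
    using mG by (rule strict_mono_less_eq)
  have fG_\<phi>: "\<forall>\<^sub>F t in at_top. fG (\<phi> t) = fH t"
    using eventually_compose_filterlim[OF assms(11) fH_top]
    by eventually_elim (simp add: \<phi>_def f_inv_into_f)
  then obtain T where T: "\<And>t. t \<ge> T \<Longrightarrow> fG (\<phi> t) = fH t"
    unfolding eventually_at_top_linorder by blast
  \<comment> \<open>\<open>inv fG\<close> is controlled only on the range of \<open>fG\<close>; past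
    \<open>T\<close> the values of \<open>\<phi>\<close> are compared through their images under
    \<open>fG\<close>.\<close>
  have mono: "\<phi> s \<le> \<phi> t" if "T \<le> s" "s \<le> t" for s t
  proof -
    have "fG (\<phi> s) \<le> fG (\<phi> t)"
      using T[of s] T[of t] that mH by (simp add: strict_mono_less_eq)
    then show ?thesis by (simp only: fG_le)
  qed
  \<comment> \<open>Substituting \<open>fH t\<close> into the first asymptotic hypothesis turns
    \<open>inv fH\<close> into the identity.\<close>
  have sub: "((\<lambda>t. \<phi> t / t) \<longlongrightarrow> 0) at_top"
    using smalloD_tendsto[OF landau_o.small.compose[OF assms(15) fH_top]] by (simp add: \<phi>_def inv_fH)
  obtain C and r :: "nat \<Rightarrow> nat" where C: "C > 0" and r: "strict_mono r"
    and VGH: "\<And>N. N > 0 \<Longrightarrow> \<forall>\<^sub>F j in sequentially.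
      vol_growth lamG SG (N * \<phi> (r j)) \<le> C * vol_growth lamH SH (2 * real (r j))"
    using integrable_growth[of T \<phi>, OF mono \<phi>_top sub] int unfolding \<phi>_def[abs_def] by blast
  obtain A where A: "A > 0" and fGV: "\<forall>\<^sub>F t in at_top. fG t \<le> A * vol_growth lamG SG (A * t)"
    using assms(13) unfolding asym_eq_def asym_le_def by blast
  obtain B where B: "B > 0" and VfH: "\<forall>\<^sub>F t in at_top. vol_growth lamH SH t \<le> B * fH (B * t)"
    using assms(14) unfolding asym_eq_def asym_le_def by blast
  \<comment> \<open>The factor \<open>2 * B\<close> combines the doubled radius with the rescaling
    in the bound of the volume growth of \<open>H\<close> by \<open>fH\<close>.\<close>
  obtain D where D: "D > 0"
    and \<phi>D: "\<forall>\<^sub>F t in at_top. norm (\<phi> (2 * B * t)) \<le> D * norm (\<phi> t)"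
  proof -
    have "(\<lambda>t. \<phi> (2 * B * t)) \<in> O[at_top](\<phi>)"
      using assms(17) B unfolding \<phi>_def by simp
    then show ?thesis by (rule landau_o.bigE) (rule that)
  qed
  \<comment> \<open>The chain of inequalities below loses the factor \<open>A * C * B\<close>; one
    more than that is incompatible with it.\<close>
  define E where "E = A * C * B + 1"
  have E: "E > 0" unfolding E_def using A B C by (simp add: add_pos_pos)
  obtain L where L: "L > 0"
    and invL: "\<forall>\<^sub>F t in at_top. norm (inv fG (E * t)) \<le> L * norm (inv fG t)"
  proof -
    have "(\<lambda>t. inv fG (E * t)) \<in> O[at_top](inv fG)"
      using assms(16) E by simp
    then show ?thesis by (rule landau_o.bigE) (rule that)
  qed
  \<comment> \<open>The second asymptotic hypothesis, evaluated at \<open>fG s\<close> and pushed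
    through \<open>fG\<close>: stretching the argument by \<open>L\<close> multiplies
    \<open>fG\<close> by at least \<open>E\<close>.\<close>
  have fGL: "\<forall>\<^sub>F s in at_top. E * fG s \<le> fG (L * s)"
  proof -
    have "filterlim (\<lambda>s. E * fG s) at_top at_top"
      using E by (intro filterlim_tendsto_pos_mult_at_top[OF tendsto_const _ fG_top])
    from eventually_compose_filterlim[OF assms(11) this]
      eventually_compose_filterlim[OF invL fG_top] eventually_ge_at_top[of 0]
    show ?thesis
    proof eventually_elim
      case (elim s)
      then have "fG (inv fG (E * fG s)) \<le> fG (L * s)"
        unfolding fG_le by (simp add: inv_fG)
      then show ?case using elim(1) by (simp add: f_inv_into_f)
    qed
  qed
  have r_top: "filterlim (\<lambda>j. real (r j)) at_top sequentially"
    by (rule filterlim_compose[OF filterlim_real_sequentially filterlim_subseq[OF r]])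
  have \<phi>r_top: "filterlim (\<lambda>j. \<phi> (r j)) at_top sequentially"
    by (rule filterlim_compose[OF \<phi>_top r_top])
  have top_mult: "filterlim (\<lambda>j. c * f j) at_top sequentially"
    if "c > 0" "filterlim f at_top sequentially" for c :: real and f
    using that by (intro filterlim_tendsto_pos_mult_at_top[OF tendsto_const])
  have ALD: "A * L * D > 0" and LD: "L * D > 0" and B2: "2 * B > 0"
    using A B L D by auto
  have "\<forall>\<^sub>F j in sequentially. False"
    using VGH[OF ALD]
      eventually_compose_filterlim[OF fGV top_mult[OF LD \<phi>r_top]]
      eventually_compose_filterlim[OF VfH top_mult[OF zero_less_numeral r_top, of "num.Bit0 num.One"]]
      eventually_compose_filterlim[OF fG_\<phi> top_mult[OF B2 r_top]]
      eventually_compose_filterlim[OF \<phi>D r_top]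
      eventually_compose_filterlim[OF fGL top_mult[OF D \<phi>r_top]]
      eventually_compose_filterlim[OF eventually_gt_at_top[of 0]
        filterlim_compose[OF fG_top top_mult[OF D \<phi>r_top]]]
      eventually_compose_filterlim[OF eventually_ge_at_top[of 0] \<phi>r_top]
  proof eventually_elim
    case (elim j)
    \<comment> \<open>With \<open>N = A * L * D\<close>, passing from \<open>fG\<close> to the
      growth of \<open>G\<close>, to that of \<open>H\<close>, to \<open>fH\<close> and back through
      \<open>\<phi>\<close> gives \<open>E * q \<le> A * C * B * q\<close>, which is impossible for
      positive \<open>q\<close>.\<close>
    define q where "q = fG (D * \<phi> (r j))"
    have q: "q > 0" using elim unfolding q_def by simp
    have "E * q \<le> fG (L * D * \<phi> (r j))"
      using elim unfolding q_def by (simp add: mult.assoc)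
    also have "\<dots> \<le> A * vol_growth lamG SG (A * L * D * \<phi> (r j))"
      using elim by (simp add: mult.assoc)
    also have "\<dots> \<le> A * (C * vol_growth lamH SH (2 * real (r j)))"
      using elim A by (intro mult_left_mono) auto
    also have "\<dots> \<le> A * (C * (B * fH (B * (2 * real (r j)))))"
      using elim A C by (intro mult_left_mono) auto
    also have "fH (B * (2 * real (r j))) = fG (\<phi> (2 * B * real (r j)))"
      using elim by (simp add: mult_ac)
    also have "A * (C * (B * fG (\<phi> (2 * B * real (r j))))) \<le> A * (C * (B * q))"
    proof -
      have "\<phi> (2 * B * real (r j)) \<le> D * \<phi> (r j)" using elim by simp
      then have "fG (\<phi> (2 * B * real (r j))) \<le> q" unfolding q_def fG_le .
      then show ?thesis using A B C by (intro mult_left_mono) auto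
    qed
    finally show False
      using q unfolding E_def by (simp add: algebra_simps)
  qed
  then show False by simp
qed

end
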